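(* Consider the problem $\min_{x\in\mathbb{R}^n}F(x)$ with $F=(F_1,\dots,F_m)$, $F_i=f_i+g_i$, where each $f_i$ is continuously differentiable and each $g_i$ is proper, convex and lower semicontinuous. Assume that $\Omega=\{x\in\mathbb{R}^n:F(x)\preceq F(x^0)\}$ is a bounded set. Let $\{x^k\}$ be the (infinite) sequence of iterates generated from $x^0$ by the Barzilai-Borwein proximal gradient method with line search (BBPGMO, described in the context), with directions $d^k$. Then: (i) $\{x^k\}$ has at least one accumulation point, and every accumulation point $x^*\in\Omega$ is a Pareto critical point. (ii) If $f_i$ is $L_i$-smooth for every $i\in[m]$, then for all $k\ge 1$ $$\min_{0\le s\le k-1}\|d^s\|\le\frac{\sqrt{\min_{i\in[m]}\{F_i(x^0)-F_i^*\}}}{\sqrt{\sigma\, t_{\min}\,\alpha_{\min}}\,\sqrt{k}},$$ where $F_i^*=\lim_{k\to\infty}F_i(x^k)$, $t_{\min}=\min\{\bar t,1\}$ and $\bar t=\min\left\{\frac{2\gamma(1-\sigma)\alpha_{\min}}{L_i}:i\in[m]\right\}$.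
   Context: Notation: $[m]=\{1,\dots,m\}$; for $u,v\in\mathbb{R}^m$, $u\preceq v$ means $u_i\le v_i$ for all $i$. $F:\mathbb{R}^n\to\mathbb{R}^m$. $F_i'(x;d)=\lim_{t\downarrow0}(F_i(x+td)-F_i(x))/t$. A point $x^*$ is Pareto critical if $\max_{i\in[m]}F_i'(x^*;d)\ge0$ for all $d\in\mathbb{R}^n$. A differentiable $h$ is $L$-smooth if $\|\nabla h(y)-\nabla h(x)\|\le L\|y-x\|$ for all $x,y$. BBPGMO with line search. Fix $\sigma,\gamma\in(0,1)$ and constants $0<\alpha_{\min}<\alpha_{\max}$ ($\alpha_{\min}$ sufficiently small, $\alpha_{\max}$ sufficiently large). Given $x^0$, choose $x^{-1}\ne x^0$ in a small neighborhood of $x^0$. For $k=0,1,2,\dots$: 1. With $s^{k-1}=x^k-x^{k-1}$ and $y_i^{k-1}=\nabla f_i(x^k)-\nabla f_i(x^{k-1})$, set for each $i\in[m]$: $\alpha_i^k=\max\{\alpha_{\min},\min\{\langle s^{k-1},y_i^{k-1}\rangle/\langle s^{k-1},s^{k-1}\rangle,\alpha_{\max}\}\}$ if $\langle s^{k-1},y_i^{k-1}\rangle>0$; $\alpha_i^k=\max\{\alpha_{\min},\min\{\|y_i^{k-1}\|/\|s^{k-1}\|,\alpha_{\max}\}\}$ if $\langle s^{k-1},y_i^{k-1}\rangle<0$; $\alpha_i^k=\alpha_{\min}$ if $\langle s^{k-1},y_i^{k-1}\rangle=0$. 2. Let $P_{\alpha^k}(x^k)$ be the unique minimizer over $x\in\mathbb{R}^n$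 of $\max_{i\in[m]}\left\{\frac{\langle\nabla f_i(x^k),x-x^k\rangle+g_i(x)-g_i(x^k)}{\alpha_i^k}+\frac12\|x-x^k\|^2\right\}$ and set $d^k=P_{\alpha^k}(x^k)-x^k$. Stop if $d^k=0$. 3. Let $t_k$ be the largest element of $\{\gamma^j:j=0,1,2,\dots\}$ such that $F_i(x^k+t_kd^k)-F_i(x^k)\le t_k\sigma\left(\langle\nabla f_i(x^k),d^k\rangle+g_i(x^k+d^k)-g_i(x^k)\right)$ for all $i\in[m]$ (Armijo backtracking starting at $1$), and set $x^{k+1}=x^k+t_kd^k$. Standing assumption: the algorithm does not stop, i.e. it produces an infinite sequence of points that are not Pareto critical. *)

theory Defs
  imports "HOL-Analysis.Analysis"
begin

text \<open>
  The nonsmooth parts \<open>g i\<close> are extended-real-valued, so that properness and lower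
  semicontinuity are genuine conditions; finite-valued \<open>g i\<close> (objective mapping into
  \<open>\<real>\<^sup>m\<close>) are the special case \<open>g i = ereal \<circ> h i\<close>.  Components are indexed by a finite
  type \<open>'m\<close>, hence \<open>MAX i. _\<close> and \<open>MIN i. _\<close> range over a nonempty finite set.
\<close>

definition proper_ereal :: "('a \<Rightarrow> ereal) \<Rightarrow> bool" where
  "proper_ereal g \<longleftrightarrow> (\<forall>x. g x \<noteq> -\<infinity>) \<and> (\<exists>x. g x \<noteq> \<infinity>)"

definition convex_ereal :: "('a::real_vector \<Rightarrow> ereal) \<Rightarrow> bool" where
  "convex_ereal g \<longleftrightarrow>
    (\<forall>x y. \<forall>u\<in>{0<..<1::real}.
       g ((1 - u) *\<^sub>R x + u *\<^sub>R y) \<le> ereal (1 - u) * g x + ereal u * g y)"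

definition lsc_ereal :: "('a::topological_space \<Rightarrow> ereal) \<Rightarrow> bool" where
  "lsc_ereal g \<longleftrightarrow> (\<forall>x. g x \<le> Liminf (at x) g)"

definition grad :: "('a::real_inner \<Rightarrow> real) \<Rightarrow> 'a \<Rightarrow> 'a" where
  "grad h x = (THE D. GDERIV h x :> D)"

definition continuously_diff :: "('a::real_inner \<Rightarrow> real) \<Rightarrow> bool" where
  "continuously_diff h \<longleftrightarrow> (\<forall>x. h differentiable (at x)) \<and> continuous_on UNIV (grad h)"

definition L_smooth :: "real \<Rightarrow> ('a::real_inner \<Rightarrow> real) \<Rightarrow> bool" where
  "L_smooth L h \<longleftrightarrow>
    (\<forall>x. h differentiable (at x)) \<and> (\<forall>x y. norm (grad h y - grad h x) \<le> L * norm (y - x))"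

definition composite :: "('m \<Rightarrow> 'a \<Rightarrow> real) \<Rightarrow> ('m \<Rightarrow> 'a \<Rightarrow> ereal) \<Rightarrow> 'm \<Rightarrow> 'a \<Rightarrow> ereal" where
  "composite f g i x = ereal (f i x) + g i x"

text \<open>
  The directional derivative is a limit in the extended reals (for finite-valued \<open>g i\<close> it is
  finite).  It is only meaningful at points where the function is finite.
\<close>

definition dir_deriv :: "('a::real_vector \<Rightarrow> ereal) \<Rightarrow> 'a \<Rightarrow> 'a \<Rightarrow> ereal" where
  "dir_deriv h x v = Lim (at_right 0) (\<lambda>t. (h (x + t *\<^sub>R v) - h x) / ereal t)"

definition pareto_critical :: "('m::finite \<Rightarrow> 'a::real_vector \<Rightarrow> ereal) \<Rightarrow> 'a \<Rightarrow> bool" where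
  "pareto_critical F x \<longleftrightarrow> (\<forall>v. (MAX i. dir_deriv (F i) x v) \<ge> 0)"

definition bb_step :: "real \<Rightarrow> real \<Rightarrow> ('a::real_inner \<Rightarrow> real) \<Rightarrow> 'a \<Rightarrow> 'a \<Rightarrow> real" where
  "bb_step \<alpha>min \<alpha>max h xprev xcur =
    (let s = xcur - xprev; y = grad h xcur - grad h xprev
     in if inner s y > 0 then max \<alpha>min (min (inner s y / inner s s) \<alpha>max)
        else if inner s y < 0 then max \<alpha>min (min (norm y / norm s) \<alpha>max)
        else \<alpha>min)"

definition subproblem_obj ::
  "('m::finite \<Rightarrow> 'a::real_inner \<Rightarrow> real) \<Rightarrow> ('m \<Rightarrow> 'a \<Rightarrow> ereal) \<Rightarrow> ('m \<Rightarrow> real) \<Rightarrow> 'a \<Rightarrow> 'a \<Rightarrow> ereal" where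
  "subproblem_obj f g \<alpha> x z =
    (MAX i. (ereal (inner (grad (f i) x) (z - x)) + g i z - g i x) / ereal (\<alpha> i)
             + ereal (1/2 * (norm (z - x))\<^sup>2))"

definition armijo ::
  "('m::finite \<Rightarrow> 'a::real_inner \<Rightarrow> real) \<Rightarrow> ('m \<Rightarrow> 'a \<Rightarrow> ereal) \<Rightarrow> real \<Rightarrow> 'a \<Rightarrow> 'a \<Rightarrow> real \<Rightarrow> bool" where
  "armijo f g \<sigma> x v t \<longleftrightarrow>
    (\<forall>i. composite f g i (x + t *\<^sub>R v) - composite f g i x
          \<le> ereal (t * \<sigma>) * (ereal (inner (grad (f i) x) v) + g i (x + v) - g i x))"

text \<open>
  An infinite run of the method: \<open>x k\<close>, \<open>d k\<close>, \<open>t k\<close> are the iterates, directions and step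
  sizes for \<open>k \<ge> 0\<close>, and \<open>xm1\<close> is the auxiliary point \<open>x\<^sup>-\<^sup>1\<close>, which may be any point other than
  \<open>x 0\<close>.  The subproblem objective is strongly convex, so \<open>x k + d k\<close> being a minimizer
  determines it uniquely.
\<close>

definition bbpgmo_run ::
  "real \<Rightarrow> real \<Rightarrow> real \<Rightarrow> real \<Rightarrow> ('m::finite \<Rightarrow> 'a::real_inner \<Rightarrow> real) \<Rightarrow> ('m \<Rightarrow> 'a \<Rightarrow> ereal) \<Rightarrow>
   'a \<Rightarrow> (nat \<Rightarrow> 'a) \<Rightarrow> (nat \<Rightarrow> 'a) \<Rightarrow> (nat \<Rightarrow> real) \<Rightarrow> bool" where
  "bbpgmo_run \<sigma> \<gamma> \<alpha>min \<alpha>max f g xm1 x d t \<longleftrightarrow>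
    xm1 \<noteq> x 0 \<and>
    (\<forall>k. let xprev = (case k of 0 \<Rightarrow> xm1 | Suc j \<Rightarrow> x j);
             \<alpha> = (\<lambda>i. bb_step \<alpha>min \<alpha>max (f i) xprev (x k))
         in is_arg_min (subproblem_obj f g \<alpha> (x k)) (\<lambda>_. True) (x k + d k) \<and>
            d k \<noteq> 0 \<and>
            t k \<in> {s \<in> range (\<lambda>j. \<gamma> ^ j). armijo f g \<sigma> (x k) (d k) s} \<and>
            (\<forall>s \<in> {s \<in> range (\<lambda>j. \<gamma> ^ j). armijo f g \<sigma> (x k) (d k) s}. s \<le> t k) \<and>
            x (Suc k) = x k + t k *\<^sub>R d k)"

end

theory Submission
  imports Defs
begin

text \<open>
  Write \<open>\<psi> i k = \<langle>\<nabla>f\<^sub>i(x\<^sup>k), d\<^sup>k\<rangle> + g\<^sub>i(x\<^sup>k + d\<^sup>k) - g\<^sub>i(x\<^sup>k)\<close>.  Minimality of \<open>x\<^sup>k + d\<^sup>k\<close> in the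
  subproblem gives \<open>\<psi> i k \<le> - \<alpha>\<^sub>m\<^sub>i\<^sub>n \<parallel>d\<^sup>k\<parallel>\<^sup>2\<close>, so the Armijo rule makes every \<open>F\<^sub>i(x\<^sup>k)\<close> decrease to a
  finite limit.  Hence \<open>t\<^sub>k \<psi> i k \<longrightarrow> 0\<close>.  Where \<open>t\<^sub>k\<close> is small, the test failed at \<open>t\<^sub>k / \<gamma>\<close> for some
  \<open>i\<close>, and uniform continuity of the gradients makes that \<open>\<psi> i k\<close> small; so \<open>max\<^sub>i \<psi> i k \<longrightarrow> 0\<close>
  along the whole sequence.

  The functions \<open>g i\<close> need not be continuous on their domains, so at an accumulation point \<open>x\<^sup>*\<close>
  one only has \<open>g\<^sub>i(x\<^sup>*) \<le> lim g\<^sub>i(x\<^sup>k)\<close>.  This inequality has the right direction: passing to the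
  limit in the optimality of \<open>x\<^sup>k + d\<^sup>k\<close> against a fixed competitor \<open>z\<close> gives, for some \<open>i\<close>,
  \<open>\<langle>\<nabla>f\<^sub>i(x\<^sup>*), z - x\<^sup>*\<rangle> + g\<^sub>i(z) - g\<^sub>i(x\<^sup>*) \<ge> - \<alpha>\<^sub>m\<^sub>a\<^sub>x/2 \<parallel>z - x\<^sup>*\<parallel>\<^sup>2\<close>, and criticality follows with
  \<open>z = x\<^sup>* + s v\<close>, \<open>s \<down> 0\<close>.  For the rate, smoothness bounds the rejected step \<open>t\<^sub>k / \<gamma>\<close> from below,
  and the decrease of \<open>F\<^sub>i\<close> is summed.
\<close>

subsection \<open>Differentiable functions along lines\<close>

text \<open>\<open>grad\<close> is a definite description, so existence and uniqueness are both
  needed. The representing vector is the adjoint of the derivative applied to 1; uniqueness follows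
  from that of derivatives.\<close>

lemma has_gradient_grad:
  fixes h :: "'a::euclidean_space \<Rightarrow> real"
  assumes "h differentiable (at x)"
  shows "(h has_derivative (\<lambda>v. inner (grad h x) v)) (at x)"
proof -
  obtain h' where h': "(h has_derivative h') (at x)"
    using assms by (auto simp: differentiable_def)
  then have "linear h'"
    by (rule has_derivative_linear)
  then have "inner v (adjoint h' 1) = h' v" for v
    using adjoint_works[of h' v 1] by simp
  then have D: "GDERIV h x :> adjoint h' 1"
    using h' by (simp add: gderiv_def)
  have "grad h x = adjoint h' 1"
    unfolding grad_def
  proof (rule the_equality)
    fix E assume "GDERIV h x :> E"
    then have "(\<lambda>v. inner v E) = (\<lambda>v. inner v (adjoint h' 1))"
      using D by (auto simp: gderiv_def intro: has_derivative_unique)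
    then show "E = adjoint h' 1"
      by (metis vector_eq_ldot)
  qed (fact D)
  with D show ?thesis
    by (simp add: gderiv_def inner_commute)
qed

lemma has_real_derivative_along:
  fixes h :: "'a::euclidean_space \<Rightarrow> real"
  assumes "\<And>x. h differentiable (at x)"
  shows "((\<lambda>s. h (x + s *\<^sub>R v)) has_real_derivative inner (grad h (x + s *\<^sub>R v)) v) (at s)"
proof -
  have "((\<lambda>s. h (x + s *\<^sub>R v)) has_derivative (\<lambda>r. inner (grad h (x + s *\<^sub>R v)) (r *\<^sub>R v))) (at s)"
    by (rule has_derivative_compose[OF _ has_gradient_grad[OF assms]]) (auto intro!: derivative_eq_intros)
  then show ?thesis
    by (simp add: has_field_derivative_def mult.commute[of _ "inner _ _"])
qed

lemma mean_value_along:
  fixes h :: "'a::euclidean_space \<Rightarrow> real"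
  assumes "\<And>x. h differentiable (at x)" and "0 < s"
  obtains r where "0 < r" "r < s" "h (x + s *\<^sub>R v) - h x = s * inner (grad h (x + r *\<^sub>R v)) v"
  using MVT2[OF assms(2), of "\<lambda>s. h (x + s *\<^sub>R v)" "\<lambda>s. inner (grad h (x + s *\<^sub>R v)) v"]
    has_real_derivative_along[OF assms(1)] by auto

text \<open>The difference of the two sides is nonincreasing in \<open>s\<close>: by Cauchy-Schwarz
  and the Lipschitz bound its derivative is nonpositive. No integral is involved.\<close>

lemma L_smooth_descent:
  fixes h :: "'a::euclidean_space \<Rightarrow> real"
  assumes "L_smooth L h" and "0 \<le> s"
  shows "h (x + s *\<^sub>R v) \<le> h x + s * inner (grad h x) v + L / 2 * s\<^sup>2 * (norm v)\<^sup>2"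
proof -
  let ?p = "\<lambda>s. h (x + s *\<^sub>R v) - s * inner (grad h x) v - L / 2 * s\<^sup>2 * (norm v)\<^sup>2"
  have diff: "h differentiable (at x)" and lip: "norm (grad h y - grad h x) \<le> L * norm (y - x)" for x y
    using assms(1) by (auto simp: L_smooth_def)
  have "?p s \<le> ?p 0"
  proof (rule DERIV_nonpos_imp_nonincreasing[OF assms(2)])
    fix r :: real assume r: "0 \<le> r" "r \<le> s"
    let ?D = "inner (grad h (x + r *\<^sub>R v) - grad h x) v - L * r * (norm v)\<^sup>2"
    have "(?p has_real_derivative ?D) (at r)"
      by (auto intro!: derivative_eq_intros has_real_derivative_along diff simp: inner_diff_left)
    moreover have "inner (grad h (x + r *\<^sub>R v) - grad h x) v \<le> L * norm (r *\<^sub>R v) * norm v"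
      using norm_cauchy_schwarz[of "grad h (x + r *\<^sub>R v) - grad h x" v]
        mult_right_mono[OF lip[of "x + r *\<^sub>R v" x], of "norm v"] by simp
    then have "?D \<le> 0"
      using r by (simp add: power2_eq_square mult.assoc)
    ultimately show "\<exists>y. (?p has_real_derivative y) (at r) \<and> y \<le> 0"
      by blast
  qed
  then show ?thesis by simp
qed

subsection \<open>Lower semicontinuous convex functions\<close>

text \<open>\<open>Liminf (at x)\<close> leaves out the point \<open>x\<close> itself; the
  assumption \<open>c < g x\<close> fills this gap.\<close>

lemma lsc_ereal_eventually_gt:
  assumes "lsc_ereal g" and "c < g x"
  shows "eventually (\<lambda>z. c < g z) (nhds x)"
proof -
  have "c < Liminf (at x) g"
    using assms by (auto simp: lsc_ereal_def intro: less_le_trans)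
  then have "eventually (\<lambda>z. c < g z) (at x)"
    by (rule less_LiminfD)
  then show ?thesis
    using assms(2) by (auto simp: eventually_at_filter elim: eventually_mono)
qed

text \<open>Otherwise a level strictly between \<open>c\<close> and \<open>g l\<close> would
  eventually lie below \<open>g (z n)\<close> and above \<open>u n\<close>.\<close>

lemma lsc_ereal_le_lim:
  assumes "lsc_ereal g" "(z \<longlongrightarrow> l) A" "A \<noteq> bot"
    and "\<And>n. g (z n) \<le> u n" "(u \<longlongrightarrow> c) A"
  shows "g l \<le> c"
proof (rule ccontr)
  assume "\<not> g l \<le> c"
  then obtain c' where c': "c < c'" "c' < g l"
    using dense[of c "g l"] by (auto simp: not_le)
  have "eventually (\<lambda>n. c' < g (z n)) A"
    using lsc_ereal_eventually_gt[OF assms(1) c'(2)] assms(2) unfolding filterlim_iff by blast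
  moreover have "eventually (\<lambda>n. u n < c') A"
    using assms(5) c'(1) by (rule order_tendstoD)
  ultimately have "eventually (\<lambda>n. False) A"
    by eventually_elim (use assms(4) in \<open>meson leD less_trans less_le_trans\<close>)
  with assms(3) show False by simp
qed

lemma lsc_ereal_bounded_below:
  fixes g :: "'a::metric_space \<Rightarrow> ereal"
  assumes "lsc_ereal g" "\<And>x. g x \<noteq> -\<infinity>" "compact K"
  shows "\<exists>M. \<forall>z\<in>K. ereal (- M) \<le> g z"
proof (rule ccontr)
  assume "\<nexists>M. \<forall>z\<in>K. ereal (- M) \<le> g z"
  then have "\<exists>z\<in>K. g z < ereal (- real n)" for n :: nat
    by (meson not_le)
  then obtain z where z: "\<And>n. z n \<in> K" "\<And>n. g (z n) < ereal (- real n)"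
    by metis
  obtain l r where r: "l \<in> K" "strict_mono (r :: nat \<Rightarrow> nat)" "(z \<circ> r) \<longlonglongrightarrow> l"
    using assms(3) z(1) unfolding compact_def by metis
  obtain N :: nat where N: "ereal (- real N) < g l"
    using assms(2)[of l] reals_Archimedean2[of "- real_of_ereal (g l)"]
    by (cases "g l") (auto simp: minus_less_iff)
  have "eventually (\<lambda>n. ereal (- real N) < g ((z \<circ> r) n)) sequentially"
    using lsc_ereal_eventually_gt[OF assms(1) N] r(3) unfolding filterlim_iff by blast
  then have "eventually (\<lambda>n. n < N) sequentially"
  proof (rule eventually_mono)
    fix n assume "ereal (- real N) < g ((z \<circ> r) n)"
    also have "\<dots> < ereal (- real (r n))" by (simp add: z)
    finally show "n < N"
      using seq_suble[OF r(2), of n] by simp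
  qed
  then show False
    by (metis eventually_sequentially linorder_not_less nle_le)
qed

lemma convex_ereal_segment:
  assumes "convex_ereal g" "g x = ereal a" "g (x + v) = ereal b" "0 \<le> u" "u \<le> 1"
  shows "g (x + u *\<^sub>R v) \<le> ereal ((1 - u) * a + u * b)"
proof (cases "u = 0 \<or> u = 1")
  case False
  then have "u \<in> {0<..<1}" using assms by auto
  then have "g ((1 - u) *\<^sub>R x + u *\<^sub>R (x + v)) \<le> ereal (1 - u) * g x + ereal u * g (x + v)"
    using assms(1) unfolding convex_ereal_def by blast
  moreover have "(1 - u) *\<^sub>R x + u *\<^sub>R (x + v) = x + u *\<^sub>R v"
    by (simp add: algebra_simps)
  ultimately show ?thesis
    using assms(2,3) by simp
qed (use assms in auto)

text \<open>The point at distance \<open>s\<close> is the convex combination of the two ends with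
  weight \<open>s / r\<close>. If the far value is infinite, so is the right-hand side.\<close>

lemma convex_ereal_quotient_mono:
  assumes "convex_ereal g" "\<And>z. g z \<noteq> -\<infinity>" "g x = ereal a" "0 < s" "s \<le> r"
  shows "(g (x + s *\<^sub>R v) - g x) / ereal s \<le> (g (x + r *\<^sub>R v) - g x) / ereal r"
proof (cases "g (x + r *\<^sub>R v)")
  case (real b)
  have "g (x + (s / r) *\<^sub>R (r *\<^sub>R v)) \<le> ereal ((1 - s / r) * a + (s / r) * b)"
    using assms real by (intro convex_ereal_segment) auto
  then have le: "g (x + s *\<^sub>R v) \<le> ereal ((1 - s / r) * a + (s / r) * b)"
    using assms by simp
  then obtain c where c: "g (x + s *\<^sub>R v) = ereal c"
    using assms(2)[of "x + s *\<^sub>R v"] by (cases "g (x + s *\<^sub>R v)") auto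
  have "c - a \<le> s / r * (b - a)"
    using le unfolding c ereal_less_eq by (simp only: algebra_simps)
  then have "(c - a) / s \<le> (b - a) / r"
    using assms(4,5) by (simp add: field_simps)
  then show ?thesis
    using assms(3,4,5) by (simp add: real c)
qed (use assms in auto)

text \<open>By monotonicity the limit is the infimum of the quotients, which may be infinite with
  either sign.\<close>

lemma convex_ereal_quotient_tendsto:
  assumes "convex_ereal g" "\<And>z. g z \<noteq> -\<infinity>" "g x = ereal a"
  shows "\<exists>q. ((\<lambda>s. (g (x + s *\<^sub>R v) - g x) / ereal s) \<longlongrightarrow> q) (at_right 0)"
proof -
  let ?q = "\<lambda>s. (g (x + s *\<^sub>R v) - g x) / ereal s"
  have "(?q \<longlongrightarrow> (INF s\<in>{0<..}. ?q s)) (at_right 0)"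
  proof (rule order_tendstoI)
    fix c assume "c < (INF s\<in>{0<..}. ?q s)"
    then have "0 < s \<Longrightarrow> c < ?q s" for s
      by (meson INF_lower greaterThan_iff less_le_trans)
    then show "eventually (\<lambda>s. c < ?q s) (at_right 0)"
      by (auto simp: eventually_at_filter)
  next
    fix c assume "(INF s\<in>{0<..}. ?q s) < c"
    then obtain r where r: "0 < r" "?q r < c"
      by (auto simp: INF_less_iff)
    have "0 < s \<Longrightarrow> s < r \<Longrightarrow> ?q s < c" for s
      using convex_ereal_quotient_mono[OF assms, of s r v] r by (auto intro: le_less_trans)
    then show "eventually (\<lambda>s. ?q s < c) (at_right 0)"
      using r(1) by (auto simp: eventually_at_right_field)
  qed
  then show ?thesis ..
qed

subsection \<open>A sufficient condition for a nonnegative directional derivative\<close>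

text \<open>Since the limit defining the directional derivative exists, a lower bound that recurs
  arbitrarily close to 0 suffices. Division by \<open>s\<close> turns the quadratic error into
  \<open>c * s\<close>, which vanishes.\<close>

lemma dir_deriv_composite_nonneg:
  fixes f :: "'m \<Rightarrow> 'a::euclidean_space \<Rightarrow> real"
  assumes "f i differentiable (at x)"
    and g: "convex_ereal (g i)" "\<And>z. g i z \<noteq> -\<infinity>" "g i x = ereal a"
    and freq: "\<exists>\<^sub>F s in at_right 0. ereal (- c * s\<^sup>2) \<le> ereal (inner (grad (f i) x) (s *\<^sub>R v)) + g i (x + s *\<^sub>R v) - g i x"
  shows "0 \<le> dir_deriv (composite f g i) x v"
proof -
  let ?p = "inner (grad (f i) x) v"
  let ?q = "\<lambda>s. (g i (x + s *\<^sub>R v) - g i x) / ereal s"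
  obtain q where q: "(?q \<longlongrightarrow> q) (at_right 0)"
    using convex_ereal_quotient_tendsto[OF g] by blast
  have "((\<lambda>s. f i (x + s *\<^sub>R v)) has_derivative (\<lambda>r. inner (grad (f i) x) (r *\<^sub>R v))) (at 0)"
    by (rule has_derivative_compose[of "\<lambda>s. x + s *\<^sub>R v" _ 0 UNIV "f i", simplified])
      (auto intro!: derivative_eq_intros has_gradient_grad assms)
  then have "((\<lambda>s. f i (x + s *\<^sub>R v)) has_real_derivative ?p) (at 0)"
    by (simp add: has_field_derivative_def mult.commute[of _ "inner _ _"])
  then have "((\<lambda>s. (f i (x + s *\<^sub>R v) - f i x) / s) \<longlongrightarrow> ?p) (at_right 0)"
    by (auto simp: has_field_derivative_iff intro: tendsto_mono[OF at_le])
  \<comment> \<open>The smooth summand has a finite limit, so the sum converges whatever the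
    extended real \<open>q\<close> is.\<close>
  then have "((\<lambda>s. ereal ((f i (x + s *\<^sub>R v) - f i x) / s) + ?q s) \<longlongrightarrow> ereal ?p + q) (at_right 0)"
    using q by (intro tendsto_add_ereal_general2) auto
  moreover have "eventually (\<lambda>s. ereal ((f i (x + s *\<^sub>R v) - f i x) / s) + ?q s
      = (composite f g i (x + s *\<^sub>R v) - composite f g i x) / ereal s) (at_right 0)"
    unfolding eventually_at_filter
  proof (intro always_eventually allI impI)
    fix s :: real assume "s \<noteq> 0" "s \<in> {0<..}"
    then show "ereal ((f i (x + s *\<^sub>R v) - f i x) / s) + ?q s
      = (composite f g i (x + s *\<^sub>R v) - composite f g i x) / ereal s"
      using g(2)[of "x + s *\<^sub>R v"] g(3)
      by (cases "g i (x + s *\<^sub>R v)") (auto simp: composite_def field_simps)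
  qed
  ultimately have "((\<lambda>s. (composite f g i (x + s *\<^sub>R v) - composite f g i x) / ereal s)
      \<longlongrightarrow> ereal ?p + q) (at_right 0)"
    by (rule Lim_transform_eventually)
  then have "dir_deriv (composite f g i) x v = ereal ?p + q"
    unfolding dir_deriv_def by (intro tendsto_Lim) auto
  moreover have "0 \<le> ereal ?p + q"
  proof (rule ccontr)
    assume "\<not> 0 \<le> ereal ?p + q"
    then obtain e where e: "ereal ?p + q < ereal e" "ereal e < 0"
      using ereal_dense2[of "ereal ?p + q" 0] by (auto simp: not_le)
    \<comment> \<open>Replacing the quotient of \<open>f i\<close> by its limit keeps the limit of
      the sum and matches the linearised expression in \<open>freq\<close>.\<close>
    have "((\<lambda>s. ereal ?p + ?q s) \<longlongrightarrow> ereal ?p + q) (at_right 0)"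
      using q by (intro tendsto_add_ereal_general2) auto
    then have "eventually (\<lambda>s. ereal ?p + ?q s < ereal e) (at_right 0)"
      using e(1) by (rule order_tendstoD)
    moreover have "((\<lambda>s. - c * s) \<longlongrightarrow> - c * 0) (at_right 0)"
      by (intro tendsto_intros)
    then have "eventually (\<lambda>s. e < - c * s) (at_right 0)"
      using e(2) by (intro order_tendstoD) auto
    moreover have "eventually (\<lambda>s::real. 0 < s) (at_right 0)"
      by (simp add: eventually_at_filter)
    ultimately have "eventually (\<lambda>s. \<not> ereal (- c * s\<^sup>2) \<le> ereal (inner (grad (f i) x) (s *\<^sub>R v)) + g i (x + s *\<^sub>R v) - g i x) (at_right 0)"
    proof eventually_elim
      case (elim s)
      obtain b where b: "g i (x + s *\<^sub>R v) = ereal b"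
        using elim g(2)[of "x + s *\<^sub>R v"] g(3) by (cases "g i (x + s *\<^sub>R v)") auto
      have "?p + (b - a) / s < - c * s"
        using elim g(3) by (simp add: b)
      then have "s * ?p + b - a < - c * s\<^sup>2"
        using elim(3) by (simp add: field_simps power2_eq_square)
      then show ?case
        by (simp add: b g(3))
    qed
    with freq show False
      by (simp add: frequently_def)
  qed
  ultimately show ?thesis by simp
qed

subsection \<open>The proximal subproblem\<close>

lemma subproblem_min_le:
  fixes f :: "'m::finite \<Rightarrow> 'a::real_inner \<Rightarrow> real"
  assumes "is_arg_min (subproblem_obj f g \<alpha> x) (\<lambda>_. True) y"
  shows "\<exists>i. (ereal (inner (grad (f j) x) (y - x)) + g j y - g j x) / ereal (\<alpha> j) + ereal (1/2 * (norm (y - x))\<^sup>2)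
    \<le> (ereal (inner (grad (f i) x) (z - x)) + g i z - g i x) / ereal (\<alpha> i) + ereal (1/2 * (norm (z - x))\<^sup>2)"
proof -
  let ?T = "\<lambda>z i. (ereal (inner (grad (f i) x) (z - x)) + g i z - g i x) / ereal (\<alpha> i) + ereal (1/2 * (norm (z - x))\<^sup>2)"
  have "?T y j \<le> subproblem_obj f g \<alpha> x y"
    unfolding subproblem_obj_def by (rule Max_ge) auto
  also have "\<dots> \<le> subproblem_obj f g \<alpha> x z"
    using assms by (auto simp: is_arg_min_def not_less)
  finally have "?T y j \<le> Max (range (?T z))"
    by (simp only: subproblem_obj_def)
  moreover have "Max (range (?T z)) \<in> range (?T z)"
    by (rule Max_in) auto
  ultimately show ?thesis by (metis (no_types, lifting) rangeE)
qed

text \<open>The competitor \<open>x\<close> itself gives every component the value 0, which rules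
  out an infinite value at the minimizer.\<close>

lemma subproblem_min_finite:
  fixes f :: "'m::finite \<Rightarrow> 'a::real_inner \<Rightarrow> real"
  assumes min: "is_arg_min (subproblem_obj f g \<alpha> x) (\<lambda>_. True) (x + d)"
    and \<alpha>: "\<And>i. 0 < \<alpha> i"
    and "\<And>z. g j z \<noteq> -\<infinity>" "\<And>i. g i x = ereal (a i)"
  shows "g j (x + d) = ereal (real_of_ereal (g j (x + d)))"
  using subproblem_min_le[OF min, of j x] assms(3)[of "x + d"] \<alpha>[of j] assms(4)
  by (cases "g j (x + d)") auto

text \<open>The minimizer is compared with the points \<open>x + u *\<^sub>R d\<close> of the
  segment, where convexity bounds the maximum of the linearised quotients by
  \<open>u * M\<close>.\<close>

lemma subproblem_min_descent:
  fixes f :: "'m::finite \<Rightarrow> 'a::real_inner \<Rightarrow> real"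
  assumes min: "is_arg_min (subproblem_obj f g \<alpha> x) (\<lambda>_. True) (x + d)"
    and \<alpha>: "\<And>i. 0 < \<alpha> i"
    and g: "\<And>i. convex_ereal (g i)" "\<And>i z. g i z \<noteq> -\<infinity>"
    and a: "\<And>i. g i x = ereal (a i)"
    and b: "\<And>i. g i (x + d) = ereal (b i)"
  shows "inner (grad (f i) x) d + b i - a i \<le> - \<alpha> i * (norm d)\<^sup>2"
proof -
  define p where "p i = (inner (grad (f i) x) d + b i - a i) / \<alpha> i" for i
  define M where "M = Max (range p)"
  define D where "D = (norm d)\<^sup>2"
  have pM: "p i \<le> M" for i
    by (simp add: M_def)
  have "M \<in> range p"
    unfolding M_def by (rule Max_in) auto
  then obtain j where j: "M = p j" by auto
  have main: "M + (1 + u) / 2 * D \<le> 0" if u: "0 < u" "u < 1" for u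
  proof -
    obtain i where "ereal (p j + 1 / 2 * D)
        \<le> (ereal (inner (grad (f i) x) (u *\<^sub>R d)) + g i (x + u *\<^sub>R d) - g i x) / ereal (\<alpha> i)
          + ereal (1 / 2 * (norm (u *\<^sub>R d))\<^sup>2)"
      using subproblem_min_le[OF min, of j "x + u *\<^sub>R d"] \<alpha>[of j] by (auto simp: a b p_def D_def)
    moreover obtain c where c: "g i (x + u *\<^sub>R d) = ereal c" "c \<le> (1 - u) * a i + u * b i"
      using convex_ereal_segment[OF g(1) a b, of u i] u g(2)[of i "x + u *\<^sub>R d"]
      by (cases "g i (x + u *\<^sub>R d)") auto
    ultimately have "p j + 1 / 2 * D \<le> (u * inner (grad (f i) x) d + c - a i) / \<alpha> i + 1 / 2 * (u\<^sup>2 * D)"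
      using \<alpha>[of i] by (simp add: a D_def power_mult_distrib)
    also have "(u * inner (grad (f i) x) d + c - a i) / \<alpha> i \<le> (u * (inner (grad (f i) x) d + b i - a i)) / \<alpha> i"
      using c(2) \<alpha>[of i] by (intro divide_right_mono) (auto simp: algebra_simps)
    also have "\<dots> = u * p i"
      by (simp add: p_def)
    also have "\<dots> \<le> u * M"
      using u pM by simp
    finally have "M + 1 / 2 * D \<le> u * M + 1 / 2 * (u\<^sup>2 * D)"
      by (simp add: j)
    moreover have "(1 - u) * (M + (1 + u) / 2 * D) = (M + 1 / 2 * D) - (u * M + 1 / 2 * (u\<^sup>2 * D))"
      by (simp add: field_simps power2_eq_square)
    ultimately have "(1 - u) * (M + (1 + u) / 2 * D) \<le> 0"
      by simp
    then show ?thesis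
      using u by (simp add: mult_le_0_iff)
  qed
  \<comment> \<open>Letting \<open>u\<close> tend to 1 yields \<open>M \<le> - D\<close>; the
    competitor \<open>x\<close> alone would give only half of this.\<close>
  have "((\<lambda>u. M + (1 + u) / 2 * D) \<longlongrightarrow> M + (1 + 1) / 2 * D) (at_left 1)"
    by (intro tendsto_intros) simp
  moreover have "eventually (\<lambda>u. M + (1 + u) / 2 * D \<le> 0) (at_left 1)"
    using main by (auto simp: eventually_at_left_field intro!: exI[of _ 0])
  ultimately have "M + (1 + 1) / 2 * D \<le> 0"
    by (rule tendsto_upperbound) simp
  then have "p i \<le> - D"
    using pM[of i] by simp
  then show ?thesis
    using \<alpha>[of i] by (simp add: p_def D_def pos_divide_le_eq mult.commute)
qed

lemma bb_step_bounds:
  assumes "\<alpha>min < \<alpha>max"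
  shows "\<alpha>min \<le> bb_step \<alpha>min \<alpha>max h y z" "bb_step \<alpha>min \<alpha>max h y z \<le> \<alpha>max"
  using assms by (auto simp: bb_step_def Let_def)

subsection \<open>Runs of the method\<close>

locale bbpgmo =
  fixes f :: "'m::finite \<Rightarrow> 'a::euclidean_space \<Rightarrow> real"
    and g :: "'m \<Rightarrow> 'a \<Rightarrow> ereal"
    and \<sigma> \<gamma> \<alpha>min \<alpha>max :: real
    and xm1 :: 'a
    and x d :: "nat \<Rightarrow> 'a"
    and t :: "nat \<Rightarrow> real"
  assumes f: "\<And>i. continuously_diff (f i)"
    and g: "\<And>i. proper_ereal (g i)" "\<And>i. convex_ereal (g i)" "\<And>i. lsc_ereal (g i)"
    and x0: "\<And>i. composite f g i (x 0) < \<infinity>"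
    and bdd: "bounded {z. \<forall>i. composite f g i z \<le> composite f g i (x 0)}"
    and \<sigma>: "0 < \<sigma>" "\<sigma> < 1"
    and \<gamma>: "0 < \<gamma>" "\<gamma> < 1"
    and \<alpha>: "0 < \<alpha>min" "\<alpha>min < \<alpha>max"
    and run: "bbpgmo_run \<sigma> \<gamma> \<alpha>min \<alpha>max f g xm1 x d t"
begin

section \<open>Real-valued data along a run\<close>

definition bb :: "'m \<Rightarrow> nat \<Rightarrow> real" where
  "bb i k = bb_step \<alpha>min \<alpha>max (f i) (case k of 0 \<Rightarrow> xm1 | Suc j \<Rightarrow> x j) (x k)"

text \<open>Real-valued copies allow ordinary arithmetic; they stand for the extended values only
  through \<open>gx_finite\<close> and \<open>gxd_finite\<close>.\<close>

definition gx :: "'m \<Rightarrow> nat \<Rightarrow> real" where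
  "gx i k = real_of_ereal (g i (x k))"

definition gxd :: "'m \<Rightarrow> nat \<Rightarrow> real" where
  "gxd i k = real_of_ereal (g i (x k + d k))"

definition Fx :: "'m \<Rightarrow> nat \<Rightarrow> real" where
  "Fx i k = f i (x k) + gx i k"

definition \<psi> :: "'m \<Rightarrow> nat \<Rightarrow> real" where
  "\<psi> i k = inner (grad (f i) (x k)) (d k) + gxd i k - gx i k"

lemma bb_bounds: "\<alpha>min \<le> bb i k" "bb i k \<le> \<alpha>max" "0 < bb i k"
  using bb_step_bounds[OF \<alpha>(2)] \<alpha>(1) by (auto simp: bb_def intro: less_le_trans)

lemma run_min: "is_arg_min (subproblem_obj f g (\<lambda>i. bb i k) (x k)) (\<lambda>_. True) (x k + d k)"
  and run_nz: "d k \<noteq> 0"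
  and run_power: "\<exists>j. t k = \<gamma> ^ j"
  and run_armijo: "armijo f g \<sigma> (x k) (d k) (t k)"
  and run_max: "armijo f g \<sigma> (x k) (d k) (\<gamma> ^ j) \<Longrightarrow> \<gamma> ^ j \<le> t k"
  and run_step: "x (Suc k) = x k + t k *\<^sub>R d k"
  using run by (auto simp: bbpgmo_run_def bb_def Let_def)

lemma t_bounds: "0 < t k" "t k \<le> 1"
proof -
  obtain j where "t k = \<gamma> ^ j" using run_power by blast
  then show "0 < t k" "t k \<le> 1" using \<gamma> by (auto simp: power_le_one)
qed

lemma g_nonminf: "g i z \<noteq> -\<infinity>"
  using g(1) by (simp add: proper_ereal_def)

lemma differentiable: "f i differentiable (at z)"
  using f by (simp add: continuously_diff_def)

lemma continuous_f: "continuous_on S (f i)"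
  using differentiable by (meson continuous_at_imp_continuous_on differentiable_imp_continuous_within)

lemma continuous_grad: "continuous_on S (grad (f i))"
  using f continuous_on_subset[OF _ subset_UNIV] by (auto simp: continuously_diff_def)

text \<open>Finiteness passes from the iterate to the minimizer, and by convexity to the new iterate
  on the segment between them. All components are carried together because the subproblem couples
  them.\<close>

lemma gx_finite: "g i (x k) = ereal (gx i k)"
proof (induction k arbitrary: i)
  case 0
  show ?case
    using x0[of i] g_nonminf[of i "x 0"] by (cases "g i (x 0)") (auto simp: composite_def gx_def)
next
  case (Suc k)
  have "g i (x k + d k) = ereal (gxd i k)"
    unfolding gxd_def by (rule subproblem_min_finite[OF run_min bb_bounds(3) g_nonminf Suc])
  then have "g i (x (Suc k)) \<le> ereal ((1 - t k) * gx i k + t k * gxd i k)"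
    unfolding run_step using t_bounds[of k] by (intro convex_ereal_segment g Suc) auto
  then show ?case
    using g_nonminf[of i "x (Suc k)"] by (cases "g i (x (Suc k))") (auto simp: gx_def)
qed

lemma gxd_finite: "g i (x k + d k) = ereal (gxd i k)"
  unfolding gxd_def by (rule subproblem_min_finite[OF run_min bb_bounds(3) g_nonminf gx_finite])

lemma composite_x: "composite f g i (x k) = ereal (Fx i k)"
  by (simp add: composite_def gx_finite Fx_def)

lemma psi_le: "\<psi> i k \<le> - \<alpha>min * (norm (d k))\<^sup>2"
proof -
  have "\<psi> i k \<le> - bb i k * (norm (d k))\<^sup>2"
    unfolding \<psi>_def
    by (rule subproblem_min_descent[OF run_min bb_bounds(3) g(2) g_nonminf gx_finite gxd_finite])
  also have "\<dots> \<le> - \<alpha>min * (norm (d k))\<^sup>2"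
    using bb_bounds by (intro mult_right_mono) auto
  finally show ?thesis .
qed

section \<open>Sufficient decrease and rejected steps\<close>

lemma Fx_step: "Fx i (Suc k) - Fx i k \<le> t k * \<sigma> * \<psi> i k"
  using run_armijo[of k, unfolded armijo_def, rule_format, of i]
  by (simp flip: run_step add: composite_x gx_finite gxd_finite \<psi>_def)

lemma Fx_decreasing: "Fx i (Suc k) \<le> Fx i k - \<sigma> * t k * \<alpha>min * (norm (d k))\<^sup>2"
proof -
  have "t k * \<sigma> * \<psi> i k \<le> t k * \<sigma> * (- \<alpha>min * (norm (d k))\<^sup>2)"
    using t_bounds[of k] \<sigma> by (intro mult_left_mono psi_le) auto
  then show ?thesis
    using Fx_step[of i k] by (simp add: mult_ac)
qed

lemma Fx_decseq: "decseq (Fx i)"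
proof (rule decseq_SucI)
  fix k
  have "0 \<le> \<sigma> * t k * \<alpha>min * (norm (d k))\<^sup>2"
    using t_bounds[of k] \<sigma> \<alpha> by simp
  then show "Fx i (Suc k) \<le> Fx i k"
    using Fx_decreasing[of i k] by linarith
qed

lemma Fx_le_0: "Fx i k \<le> Fx i 0"
  using Fx_decseq by (simp add: decseqD)

text \<open>The predecessor \<open>t k / \<gamma>\<close> of the accepted power was rejected for
  some component. Convexity of \<open>g i\<close> on the segment removes the nonsmooth part, leaving
  an inequality on the linearisation error of \<open>f i\<close>.\<close>

lemma backtracking_failure:
  assumes "t k < 1"
  obtains s i where "s = t k / \<gamma>" "0 < s" "s \<le> 1"
    "s * ((1 - \<sigma>) * (- \<psi> i k)) < f i (x k + s *\<^sub>R d k) - f i (x k) - s * inner (grad (f i) (x k)) (d k)"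
proof -
  obtain j where j: "t k = \<gamma> ^ j" using run_power by blast
  \<comment> \<open>A step below 1 has a positive exponent, so the preceding power is itself a trial
    step.\<close>
  with assms obtain l where l: "j = Suc l" by (cases j) auto
  define s where "s = \<gamma> ^ l"
  have s: "s = t k / \<gamma>" "0 < s" "s \<le> 1"
    using \<gamma> by (auto simp: s_def j l power_le_one)
  have "t k < s"
    using \<gamma> s(2) by (simp add: j l flip: s_def)
  then have "\<not> armijo f g \<sigma> (x k) (d k) s"
    using run_max[of k l] by (auto simp: s_def)
  then obtain i where i: "\<not> composite f g i (x k + s *\<^sub>R d k) - composite f g i (x k)
      \<le> ereal (s * \<sigma>) * (ereal (inner (grad (f i) (x k)) (d k)) + g i (x k + d k) - g i (x k))"
    by (auto simp: armijo_def)
  obtain c where c: "g i (x k + s *\<^sub>R d k) = ereal c" "c \<le> (1 - s) * gx i k + s * gxd i k"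
    using convex_ereal_segment[OF g(2) gx_finite gxd_finite, of s i k] s g_nonminf[of i "x k + s *\<^sub>R d k"]
    by (cases "g i (x k + s *\<^sub>R d k)") auto
  have "s * \<sigma> * \<psi> i k < f i (x k + s *\<^sub>R d k) + c - (f i (x k) + gx i k)"
    using i by (simp add: composite_def c(1) gx_finite gxd_finite \<psi>_def)
  with c(2) have "s * ((1 - \<sigma>) * (- \<psi> i k)) < f i (x k + s *\<^sub>R d k) - f i (x k) - s * inner (grad (f i) (x k)) (d k)"
    by (simp add: \<psi>_def algebra_simps)
  with s show thesis by (rule that)
qed

section \<open>Boundedness of the run and vanishing of the optimality measure\<close>

lemma x_bounded: "\<exists>R>0. \<forall>k. norm (x k) \<le> R"
proof -
  have "x k \<in> {z. \<forall>i. composite f g i z \<le> composite f g i (x 0)}" for k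
    by (simp add: composite_x Fx_le_0)
  then show ?thesis
    using bdd by (meson bounded_pos)
qed

text \<open>Compactness supplies the bounds, and the finitely many components share the largest
  constant. For \<open>g i\<close>, which may be infinite, lower semicontinuity gives the lower
  bound.\<close>

lemma data_bounds:
  "\<exists>M. \<forall>i. \<forall>z\<in>cball 0 R. ereal (- M) \<le> g i z \<and> - M \<le> f i z \<and> norm (grad (f i) z) \<le> M"
proof -
  have "\<exists>M. \<forall>z\<in>cball 0 R. ereal (- M) \<le> g i z \<and> - M \<le> f i z \<and> norm (grad (f i) z) \<le> M" for i
  proof -
    obtain A where A: "\<forall>z\<in>cball 0 R. ereal (- A) \<le> g i z"
      using lsc_ereal_bounded_below[OF g(3) g_nonminf compact_cball] by blast
    obtain B where B: "\<forall>z\<in>cball 0 R. norm (f i z) \<le> B"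
      using compact_imp_bounded[OF compact_continuous_image[OF continuous_f compact_cball]]
      unfolding bounded_iff by (metis image_eqI)
    obtain C where C: "\<forall>z\<in>cball 0 R. norm (grad (f i) z) \<le> C"
      using compact_imp_bounded[OF compact_continuous_image[OF continuous_grad compact_cball]]
      unfolding bounded_iff by (metis image_eqI)
    have "\<forall>z\<in>cball 0 R. ereal (- max A (max B C)) \<le> g i z \<and> - max A (max B C) \<le> f i z \<and>
        norm (grad (f i) z) \<le> max A (max B C)"
    proof (intro ballI conjI)
      fix z assume z: "z \<in> cball (0::'a) R"
      have "ereal (- max A (max B C)) \<le> ereal (- A)" by simp
      also have "\<dots> \<le> g i z" using A z by blast
      finally show "ereal (- max A (max B C)) \<le> g i z" .
      show "- max A (max B C) \<le> f i z" using B z by fastforce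
      show "norm (grad (f i) z) \<le> max A (max B C)" using C z by fastforce
    qed
    then show ?thesis ..
  qed
  then obtain M where M: "\<And>i z. z \<in> cball 0 R \<Longrightarrow>
      ereal (- M i) \<le> g i z \<and> - M i \<le> f i z \<and> norm (grad (f i) z) \<le> M i"
    by metis
  let ?N = "Max (range M)"
  have le: "M i \<le> ?N" for i by simp
  have "\<forall>i. \<forall>z\<in>cball 0 R. ereal (- ?N) \<le> g i z \<and> - ?N \<le> f i z \<and> norm (grad (f i) z) \<le> ?N"
  proof (intro allI ballI conjI)
    fix i z assume z: "z \<in> cball (0::'a) R"
    have "ereal (- ?N) \<le> ereal (- M i)" using le[of i] by simp
    also have "\<dots> \<le> g i z" using M z by blast
    finally show "ereal (- ?N) \<le> g i z" .
    show "- ?N \<le> f i z" "norm (grad (f i) z) \<le> ?N" using M[OF z, of i] le[of i] by linarith+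
  qed
  then show ?thesis ..
qed

lemma Fx_convergent: "\<exists>l. Fx i \<longlonglongrightarrow> l"
proof -
  obtain R where R: "\<And>k. norm (x k) \<le> R" using x_bounded by blast
  obtain M where M: "\<And>i z. z \<in> cball 0 R \<Longrightarrow> ereal (- M) \<le> g i z \<and> - M \<le> f i z"
    using data_bounds by blast
  have "- M - M \<le> Fx i k" for k
    using M[of "x k" i] R[of k] by (simp add: Fx_def gx_finite)
  then show ?thesis
    using decseq_convergent[OF Fx_decseq] by metis
qed

text \<open>Convexity lets \<open>g i\<close> fall at most linearly along the direction, whereas
  \<open>psi_le\<close> demands a quadratic decrease in \<open>norm (d k)\<close>; long directions
  are therefore impossible.\<close>

lemma d_bounded: "\<exists>D\<ge>1. \<forall>k. norm (d k) \<le> D"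
proof -
  obtain R where R: "\<And>k. norm (x k) \<le> R" using x_bounded by blast
  obtain M where M: "\<And>i z. z \<in> cball 0 (R + 1) \<Longrightarrow>
      ereal (- M) \<le> g i z \<and> - M \<le> f i z \<and> norm (grad (f i) z) \<le> M"
    using data_bounds by blast
  fix i :: 'm
  define D where "D = max 1 ((3 * M + Fx i 0) / \<alpha>min)"
  have "norm (d k) \<le> D" for k
  proof (cases "norm (d k) \<le> 1")
    case False
    \<comment> \<open>The point at unit distance along \<open>d k\<close> stays in the ball of
      radius \<open>R + 1\<close>, where \<open>g i\<close> is bounded below.\<close>
    let ?n = "norm (d k)" and ?v = "(1 / norm (d k)) *\<^sub>R d k"
    have "norm (x k + ?v) \<le> R + 1"
      using norm_triangle_le[of "x k" ?v "R + 1"] R[of k] run_nz[of k] by simp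
    then have "ereal (- M) \<le> g i (x k + ?v)"
      using M by simp
    also have "\<dots> \<le> ereal ((1 - 1 / ?n) * gx i k + (1 / ?n) * gxd i k)"
      using False by (intro convex_ereal_segment g gx_finite gxd_finite) (auto simp: divide_le_eq_1)
    finally have "- M \<le> (1 - 1 / ?n) * gx i k + (1 / ?n) * gxd i k"
      by simp
    then have "?n * (- M) \<le> ?n * ((1 - 1 / ?n) * gx i k + (1 / ?n) * gxd i k)"
      by (intro mult_left_mono) auto
    also have "\<dots> = ?n * gx i k + (gxd i k - gx i k)"
      using run_nz[of k] by (simp add: field_simps)
    finally have growth: "- ?n * (M + gx i k) \<le> gxd i k - gx i k"
      by (simp add: algebra_simps)
    have fx: "- M \<le> f i (x k)" "norm (grad (f i) (x k)) \<le> M"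
      using M[of "x k" i] R[of k] by auto
    have "- (M * ?n) \<le> inner (grad (f i) (x k)) (d k)"
      using Cauchy_Schwarz_ineq2[of "grad (f i) (x k)" "d k"] mult_right_mono[OF fx(2), of ?n] by auto
    with growth have "- ?n * (2 * M + gx i k) \<le> \<psi> i k"
      by (simp add: \<psi>_def algebra_simps)
    with psi_le[of i k] have "?n * (\<alpha>min * ?n) \<le> ?n * (2 * M + gx i k)"
      by (simp add: power2_eq_square algebra_simps)
    then have "\<alpha>min * ?n \<le> 2 * M + gx i k"
      using run_nz[of k] by simp
    \<comment> \<open>An upper bound for \<open>gx i k\<close> comes from monotone objective values
      and the lower bound on \<open>f i\<close>.\<close>
    also have "\<dots> \<le> 3 * M + Fx i 0"
      using fx(1) Fx_le_0[of i k] by (simp add: Fx_def)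
    finally have "?n \<le> (3 * M + Fx i 0) / \<alpha>min"
      using \<alpha> by (simp add: field_simps)
    then show ?thesis
      by (simp add: D_def)
  qed (simp add: D_def)
  moreover have "1 \<le> D" by (simp add: D_def)
  ultimately show ?thesis by blast
qed

text \<open>
  The steps with \<open>t k < \<tau>\<close> are controlled by the failed Armijo test, the others by convergence of
  \<open>Fx i\<close>.
\<close>

lemma psi_eventually:
  assumes "0 < \<epsilon>"
  shows "eventually (\<lambda>k. \<exists>i. - \<epsilon> \<le> \<psi> i k) sequentially"
proof -
  obtain R where R: "\<And>k. norm (x k) \<le> R" using x_bounded by blast
  obtain D where D: "1 \<le> D" "\<And>k. norm (d k) \<le> D" using d_bounded by blast
  \<comment> \<open>The ball contains every segment from \<open>x k\<close> to
    \<open>x k + d k\<close>. The gradient tolerance is chosen so that multiplying it by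
    \<open>D\<close> gives \<open>(1 - \<sigma>) * \<epsilon>\<close>.\<close>
  let ?K = "cball (0::'a) (R + D)" and ?e = "(1 - \<sigma>) * \<epsilon> / D"
  have e: "0 < ?e" using assms \<sigma> D by simp
  have "\<exists>\<delta>>0. \<forall>y\<in>?K. \<forall>z\<in>?K. dist z y < \<delta> \<longrightarrow> dist (grad (f i) z) (grad (f i) y) < ?e" for i
    using compact_uniformly_continuous[OF continuous_grad compact_cball] e
    unfolding uniformly_continuous_on_def by blast
  then obtain \<Delta> where \<Delta>: "\<And>i. 0 < \<Delta> i"
    "\<And>i y z. y \<in> ?K \<Longrightarrow> z \<in> ?K \<Longrightarrow> dist z y < \<Delta> i \<Longrightarrow> dist (grad (f i) z) (grad (f i) y) < ?e"
    by metis
  define \<delta> where "\<delta> = Min (range \<Delta>)"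
  have \<delta>: "0 < \<delta>" "\<And>i. \<delta> \<le> \<Delta> i"
    by (auto simp: \<delta>_def \<Delta>(1))
  \<comment> \<open>Below \<open>\<tau>\<close> a rejection has occurred, and the rejected
    displacement is shorter than \<open>\<delta>\<close>.\<close>
  define \<tau> where "\<tau> = min 1 (\<gamma> * \<delta> / D)"
  have \<tau>: "0 < \<tau>"
    using \<gamma> \<delta> D by (simp add: \<tau>_def)
  have short: "\<exists>i. - \<epsilon> \<le> \<psi> i k" if tk: "t k < \<tau>" for k
  proof -
    have "t k < 1" using tk by (simp add: \<tau>_def)
    then obtain s i where s: "s = t k / \<gamma>" "0 < s" "s \<le> 1"
      "s * ((1 - \<sigma>) * (- \<psi> i k)) < f i (x k + s *\<^sub>R d k) - f i (x k) - s * inner (grad (f i) (x k)) (d k)"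
      by (rule backtracking_failure)
    obtain r where r: "0 < r" "r < s"
      "f i (x k + s *\<^sub>R d k) - f i (x k) = s * inner (grad (f i) (x k + r *\<^sub>R d k)) (d k)"
      using mean_value_along[OF differentiable s(2)] by blast
    have "s * ((1 - \<sigma>) * (- \<psi> i k)) < s * inner (grad (f i) (x k + r *\<^sub>R d k) - grad (f i) (x k)) (d k)"
      using s(4) r(3) by (simp add: inner_diff_left right_diff_distrib)
    then have "(1 - \<sigma>) * (- \<psi> i k) < inner (grad (f i) (x k + r *\<^sub>R d k) - grad (f i) (x k)) (d k)"
      using s(2) by (simp only: mult_less_cancel_left_pos)
    also have "\<dots> \<le> norm (grad (f i) (x k + r *\<^sub>R d k) - grad (f i) (x k)) * norm (d k)"
      by (rule norm_cauchy_schwarz)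
    also have "\<dots> \<le> ?e * D"
    proof (intro mult_mono D)
      have rd: "norm (r *\<^sub>R d k) \<le> r * D"
        using r(1) D(2)[of k] by simp
      have "r * D < \<delta>"
      proof -
        have "r * D < s * D" using r D(1) by simp
        also have "\<dots> < \<delta>"
          using tk \<gamma> D(1) by (simp add: s(1) \<tau>_def field_simps)
        finally show ?thesis .
      qed
      then have "dist (x k + r *\<^sub>R d k) (x k) < \<Delta> i"
        using rd \<delta>(2)[of i] by (simp add: dist_norm)
      moreover have "r * D \<le> D"
        using r s(3) D(1) by (simp add: mult_le_cancel_right1)
      then have "norm (x k + r *\<^sub>R d k) \<le> R + D"
        using norm_triangle_ineq[of "x k" "r *\<^sub>R d k"] R[of k] rd by linarith
      moreover have "norm (x k) \<le> R + D"
        using R[of k] D(1) by linarith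
      ultimately show "norm (grad (f i) (x k + r *\<^sub>R d k) - grad (f i) (x k)) \<le> ?e"
        using \<Delta>(2)[of "x k" "x k + r *\<^sub>R d k" i]
        by (simp add: dist_norm[of "grad _ _"] less_imp_le del: mem_cball)
    qed (use e in auto)
    also have "\<dots> = (1 - \<sigma>) * \<epsilon>"
      using D(1) by simp
    finally have "- \<psi> i k < \<epsilon>"
      using \<sigma> by (simp only: mult_less_cancel_left_pos diff_gt_0_iff_gt)
    then show ?thesis by (intro exI[of _ i]) simp
  qed
  fix i :: 'm
  obtain l where "Fx i \<longlonglongrightarrow> l" using Fx_convergent by blast
  then have "(\<lambda>k. Fx i k - Fx i (Suc k)) \<longlonglongrightarrow> l - l"
    by (intro tendsto_diff LIMSEQ_Suc)
  then have "eventually (\<lambda>k. Fx i k - Fx i (Suc k) < \<sigma> * \<epsilon> * \<tau>) sequentially"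
    using \<sigma> assms \<tau> by (intro order_tendstoD) auto
  then show ?thesis
  proof (rule eventually_mono)
    fix k assume k: "Fx i k - Fx i (Suc k) < \<sigma> * \<epsilon> * \<tau>"
    show "\<exists>i. - \<epsilon> \<le> \<psi> i k"
    proof (cases "- \<epsilon> \<le> \<psi> i k")
      case False
      \<comment> \<open>If this component is not small, the nearly stationary objective forces a
        short step, and \<open>short\<close> supplies a possibly different component.\<close>
      then have "t k * \<sigma> * \<psi> i k \<le> t k * \<sigma> * (- \<epsilon>)"
        using t_bounds[of k] \<sigma> by (intro mult_left_mono) auto
      with Fx_step[of i k] k have "(\<sigma> * \<epsilon>) * t k < (\<sigma> * \<epsilon>) * \<tau>"
        by (simp add: algebra_simps)
      then have "t k < \<tau>"
        using \<sigma> assms by (simp add: mult_less_cancel_left_pos)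
      then show ?thesis by (rule short)
    qed blast
  qed
qed

section \<open>Accumulation points\<close>

text \<open>The limit \<open>G i\<close> exists because both \<open>Fx i\<close> and
  \<open>f i\<close> converge along the subsequence; lower semicontinuity then compares it with the
  value at \<open>xs\<close>.\<close>

lemma accumulation_point_value:
  assumes "strict_mono r" "(x \<circ> r) \<longlonglongrightarrow> xs"
  shows "\<exists>a G. \<forall>i. g i xs = ereal (a i) \<and> a i \<le> G i \<and> (\<lambda>n. gx i (r n)) \<longlonglongrightarrow> G i \<and> f i xs + G i \<le> Fx i 0"
proof -
  have "\<forall>i. \<exists>l. Fx i \<longlonglongrightarrow> l" using Fx_convergent by blast
  then obtain l where l: "\<And>i. Fx i \<longlonglongrightarrow> l i" by metis
  define G where "G i = l i - f i xs" for i
  have lim: "(\<lambda>n. gx i (r n)) \<longlonglongrightarrow> G i" for i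
  proof -
    have "(\<lambda>n. f i (x (r n))) \<longlonglongrightarrow> f i xs"
      using continuous_on_tendsto_compose[OF continuous_f[of UNIV i] assms(2)] by (simp add: o_def)
    then have "(\<lambda>n. Fx i (r n) - f i (x (r n))) \<longlonglongrightarrow> l i - f i xs"
      using LIMSEQ_subseq_LIMSEQ[OF l assms(1)] by (intro tendsto_diff) (auto simp: o_def)
    then show ?thesis by (simp add: Fx_def G_def)
  qed
  have le: "g i xs \<le> ereal (G i)" for i
    using g(3) assms(2) by (rule lsc_ereal_le_lim[where u = "\<lambda>n. ereal (gx i (r n))"])
      (auto simp: gx_finite lim)
  have "l i \<le> Fx i 0" for i
    using l by (rule LIMSEQ_le_const2) (auto simp: Fx_le_0)
  then have bound: "f i xs + G i \<le> Fx i 0" for i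
    by (simp add: G_def)
  have a: "g i xs = ereal (real_of_ereal (g i xs))" for i
    using le[of i] g_nonminf[of i xs] by (cases "g i xs") auto
  then have "real_of_ereal (g i xs) \<le> G i" for i
    using le[of i] by (metis ereal_less_eq(3))
  with a lim bound show ?thesis
    by (intro exI[of _ "\<lambda>i. real_of_ereal (g i xs)"] exI[of _ G]) blast
qed

lemma accumulation_point_in_level_set:
  assumes "strict_mono r" "(x \<circ> r) \<longlonglongrightarrow> xs"
  shows "composite f g i xs \<le> composite f g i (x 0)"
proof -
  obtain a G where "g i xs = ereal (a i)" "a i \<le> G i" "f i xs + G i \<le> Fx i 0"
    using accumulation_point_value[OF assms] by blast
  then show ?thesis
    unfolding composite_x by (simp add: composite_def)
qed

text \<open>If all components failed, they would fail by a common margin near the limit, against the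
  optimality of \<open>x k + d k\<close> with a nearly zero optimal value.\<close>

lemma accumulation_point_growth:
  assumes r: "strict_mono r" "(x \<circ> r) \<longlonglongrightarrow> xs"
  shows "\<exists>i. ereal (- (\<alpha>max / 2 * (norm (z - xs))\<^sup>2)) \<le> ereal (inner (grad (f i) xs) (z - xs)) + g i z - g i xs"
proof (rule ccontr)
  assume "\<not> ?thesis"
  then have neg: "\<not> ereal (- (\<alpha>max / 2 * (norm (z - xs))\<^sup>2)) \<le> ereal (inner (grad (f i) xs) (z - xs)) + g i z - g i xs" for i
    by blast
  obtain a G where a: "\<And>i. g i xs = ereal (a i)" and aG: "\<And>i. a i \<le> G i"
    and G: "\<And>i. (\<lambda>n. gx i (r n)) \<longlonglongrightarrow> G i"
    using accumulation_point_value[OF r] by blast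
  \<comment> \<open>An infinite value at \<open>z\<close> would make the negated inequality
    true.\<close>
  have b: "g i z = ereal (real_of_ereal (g i z))" for i
    using neg[of i] g_nonminf[of i z] by (cases "g i z") (auto simp: a)
  define b where "b i = real_of_ereal (g i z)" for i
  note b = b[folded b_def]
  \<comment> \<open>\<open>G i\<close> is used instead of \<open>a i\<close> so that
    \<open>c i\<close> is the actual limit of \<open>cn i\<close>; since
    \<open>a i \<le> G i\<close>, it remains negative.\<close>
  define c where "c i = inner (grad (f i) xs) (z - xs) + b i - G i + \<alpha>max / 2 * (norm (z - xs))\<^sup>2" for i
  define cn where "cn i k = inner (grad (f i) (x k)) (z - x k) + b i - gx i k + \<alpha>max / 2 * (norm (z - x k))\<^sup>2" for i k
  have c: "c i < 0" for i
    using neg[of i] aG[of i] by (simp add: c_def a b not_le)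
  define m where "m = Max (range c)"
  define e where "e = - m / 2"
  have "m < 0"
    unfolding m_def using c by (subst Max_less_iff) auto
  then have "0 < e"
    by (simp add: e_def)
  have cm: "c i \<le> m" for i
    unfolding m_def by (rule Max_ge) auto
  have ce: "c i < - e" for i
    using \<open>m < 0\<close> cm[of i] unfolding e_def by linarith
  have "(\<lambda>n. grad (f i) (x (r n))) \<longlonglongrightarrow> grad (f i) xs" for i
    using continuous_on_tendsto_compose[OF continuous_grad[of UNIV i] r(2)] by (simp add: o_def)
  then have "(\<lambda>n. cn i (r n)) \<longlonglongrightarrow> c i" for i
    unfolding cn_def c_def using G r(2) by (intro tendsto_intros) (auto simp: o_def)
  then have "eventually (\<lambda>n. cn i (r n) < - e) sequentially" for i
    using ce by (rule order_tendstoD)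
  then have "eventually (\<lambda>n. \<forall>i. cn i (r n) < - e) sequentially"
    by (rule eventually_all_finite)
  moreover
  \<comment> \<open>The halved quotient makes \<open>\<alpha>max * \<epsilon>\<close> smaller than
    the margin \<open>e\<close>. The tolerance on \<open>\<psi>\<close> carries a factor
    \<open>\<alpha>min\<close>, which division by \<open>bb j k\<close> absorbs.\<close>
  define \<epsilon> where "\<epsilon> = e / (2 * \<alpha>max)"
  have \<epsilon>: "0 < \<epsilon>" "\<alpha>max * \<epsilon> < e"
    using \<alpha> \<open>0 < e\<close> by (auto simp: \<epsilon>_def)
  then have "eventually (\<lambda>k. \<exists>i. - (\<alpha>min * \<epsilon>) \<le> \<psi> i k) sequentially"
    using \<alpha> by (intro psi_eventually) auto
  then have "eventually (\<lambda>n. \<exists>i. - (\<alpha>min * \<epsilon>) \<le> \<psi> i (r n)) sequentially"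
    by (rule eventually_subseq[OF r(1)])
  ultimately have "eventually (\<lambda>n. False) sequentially"
  proof eventually_elim
    case (elim n)
    define k where "k = r n"
    obtain j where j: "- (\<alpha>min * \<epsilon>) \<le> \<psi> j k"
      using elim by (auto simp: k_def)
    have "\<alpha>min * \<epsilon> \<le> bb j k * \<epsilon>"
      using \<epsilon> bb_bounds[of j k] by (intro mult_right_mono) auto
    with j have "- \<epsilon> \<le> \<psi> j k / bb j k"
      using bb_bounds(3)[of j k] by (simp add: pos_le_divide_eq mult.commute)
    also have "\<dots> \<le> \<psi> j k / bb j k + 1/2 * (norm (d k))\<^sup>2"
      by simp
    also obtain i where "\<psi> j k / bb j k + 1/2 * (norm (d k))\<^sup>2
        \<le> (inner (grad (f i) (x k)) (z - x k) + b i - gx i k) / bb i k + 1/2 * (norm (z - x k))\<^sup>2"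
      using subproblem_min_le[OF run_min, of j k z] less_imp_neq[OF bb_bounds(3)]
      by (auto simp: gx_finite gxd_finite b \<psi>_def)
    also have "\<dots> = (inner (grad (f i) (x k)) (z - x k) + b i - gx i k + bb i k / 2 * (norm (z - x k))\<^sup>2) / bb i k"
      using bb_bounds(3)[of i k] by (simp add: field_simps)
    \<comment> \<open>Raising the quadratic coefficient to \<open>\<alpha>max\<close> removes the
      varying step parameter from the numerator, which can then pass to the limit.\<close>
    also have "\<dots> \<le> cn i k / bb i k"
      using bb_bounds[of i k] by (intro divide_right_mono) (auto simp: cn_def mult_right_mono)
    finally have "- (bb i k * \<epsilon>) \<le> cn i k"
      using bb_bounds(3)[of i k] by (simp add: pos_le_divide_eq mult.commute)
    moreover have "cn i k < - e"
      using elim by (simp add: k_def)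
    moreover have "bb i k * \<epsilon> \<le> \<alpha>max * \<epsilon>"
      using \<epsilon> bb_bounds[of i k] by (intro mult_right_mono) auto
    ultimately show False
      using \<epsilon>(2) by linarith
  qed
  then show False by simp
qed

lemma accumulation_point_critical:
  assumes r: "strict_mono r" "(x \<circ> r) \<longlonglongrightarrow> xs"
  shows "pareto_critical (composite f g) xs"
  unfolding pareto_critical_def
proof
  fix v
  let ?P = "\<lambda>i s. ereal (- (\<alpha>max / 2 * (norm v)\<^sup>2) * s\<^sup>2) \<le> ereal (inner (grad (f i) xs) (s *\<^sub>R v)) + g i (xs + s *\<^sub>R v) - g i xs"
  have ex: "\<exists>i. ?P i s" for s
    using accumulation_point_growth[OF r, of "xs + s *\<^sub>R v"] by (simp add: power_mult_distrib mult_ac)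
  \<comment> \<open>The good component may vary with \<open>s\<close>; as there are finitely many,
    one of them recurs arbitrarily close to 0.\<close>
  have "\<exists>i. \<exists>\<^sub>F s in at_right 0. ?P i s"
  proof (rule ccontr)
    assume "\<not> ?thesis"
    then have "eventually (\<lambda>s. \<not> ?P i s) (at_right 0)" for i
      unfolding frequently_def by blast
    then have "eventually (\<lambda>s. \<forall>i. \<not> ?P i s) (at_right 0)"
      by (rule eventually_all_finite)
    then have "eventually (\<lambda>s::real. False) (at_right 0)"
      by (rule eventually_mono) (use ex in blast)
    then show False by simp
  qed
  then obtain i where i: "\<exists>\<^sub>F s in at_right 0. ?P i s" ..
  obtain a where a: "\<And>i. g i xs = ereal (a i)"
    using accumulation_point_value[OF r] by blast
  from differentiable g(2) g_nonminf a[of i] i have "0 \<le> dir_deriv (composite f g i) xs v"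
    by (rule dir_deriv_composite_nonneg)
  also have "\<dots> \<le> (MAX i. dir_deriv (composite f g i) xs v)"
    by (rule Max_ge) auto
  finally show "0 \<le> (MAX i. dir_deriv (composite f g i) xs v)" .
qed

lemma accumulation_point_exists: "\<exists>xs r. strict_mono r \<and> (x \<circ> r) \<longlonglongrightarrow> xs"
proof -
  obtain R where "\<And>k. norm (x k) \<le> R" using x_bounded by blast
  then have "\<forall>k. x k \<in> cball 0 R" by simp
  then show ?thesis
    using compact_cball[of 0 R] unfolding compact_def by metis
qed

section \<open>Step size bound and convergence rate\<close>

text \<open>At a rejected step the linearisation error exceeds a multiple of \<open>s\<close>, while
  smoothness bounds it by a multiple of \<open>s\<^sup>2\<close>. Cancelling \<open>s\<close> and
  the nonzero squared norm of \<open>d k\<close> bounds \<open>s = t k / \<gamma>\<close> from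
  below.\<close>

lemma step_size_lower_bound:
  assumes L: "\<And>i. 0 < L i" "\<And>i. L_smooth (L i) (f i)"
  shows "min (MIN i. 2 * \<gamma> * (1 - \<sigma>) * \<alpha>min / L i) 1 \<le> t k"
proof (cases "t k < 1")
  case True
  then obtain s i where s: "s = t k / \<gamma>" "0 < s"
    "s * ((1 - \<sigma>) * (- \<psi> i k)) < f i (x k + s *\<^sub>R d k) - f i (x k) - s * inner (grad (f i) (x k)) (d k)"
    by (rule backtracking_failure)
  have "s * ((1 - \<sigma>) * (\<alpha>min * (norm (d k))\<^sup>2)) \<le> s * ((1 - \<sigma>) * (- \<psi> i k))"
    using s \<sigma> psi_le[of i k] by (intro mult_left_mono) auto
  also have "\<dots> < L i / 2 * s\<^sup>2 * (norm (d k))\<^sup>2"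
    using L_smooth_descent[OF L(2), of s i "x k" "d k"] s by linarith
  finally have "(s * (norm (d k))\<^sup>2) * ((1 - \<sigma>) * \<alpha>min) < (s * (norm (d k))\<^sup>2) * (L i / 2 * s)"
    by (simp add: power2_eq_square mult_ac)
  then have "(1 - \<sigma>) * \<alpha>min < L i / 2 * s"
    using s(2) run_nz[of k] by (simp add: mult_less_cancel_left_pos)
  then have "2 * \<gamma> * (1 - \<sigma>) * \<alpha>min / L i < t k"
    using \<gamma> L(1)[of i] by (simp add: s(1) field_simps)
  moreover have "(MIN i. 2 * \<gamma> * (1 - \<sigma>) * \<alpha>min / L i) \<le> 2 * \<gamma> * (1 - \<sigma>) * \<alpha>min / L i"
    by (rule Min_le) auto
  ultimately show ?thesis by linarith
qed auto

lemma convergence_rate: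
  assumes lim: "\<And>i. Fx i \<longlonglongrightarrow> l i"
    and \<tau>: "0 < \<tau>" "\<And>k. \<tau> \<le> t k"
    and k: "1 \<le> k"
  shows "(MIN s\<in>{0..k-1}. norm (d s)) \<le> sqrt (MIN i. Fx i 0 - l i) / (sqrt (\<sigma> * \<tau> * \<alpha>min) * sqrt (real k))"
proof -
  let ?m = "MIN s\<in>{0..k-1}. norm (d s)" and ?C = "\<sigma> * \<tau> * \<alpha>min"
  have C: "0 < ?C" using \<sigma> \<tau> \<alpha> by simp
  have m: "?m \<le> norm (d s)" if "s < k" for s
    using that by (intro Min_le) auto
  have m0: "0 \<le> ?m"
    by (subst Min_ge_iff) auto
  \<comment> \<open>Telescoped decrease: each of the first \<open>k\<close> steps lowers
    \<open>Fx i\<close> by at least \<open>?C * ?m\<^sup>2\<close>.\<close>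
  have bound: "Fx i j \<le> Fx i 0 - real j * (?C * ?m\<^sup>2)" if "j \<le> k" for i j
    using that
  proof (induction j)
    case (Suc j)
    have "?C * ?m\<^sup>2 \<le> \<sigma> * t j * \<alpha>min * (norm (d j))\<^sup>2"
      using \<sigma> \<tau>(2) less_imp_le[OF \<tau>(1)] \<alpha> m m0 t_bounds(1)[of j] Suc.prems by (intro mult_mono power_mono mult_nonneg_nonneg) auto
    then show ?case
      using Suc Fx_decreasing[of i j] by (simp add: algebra_simps)
  qed simp
  \<comment> \<open>The limit lies below \<open>Fx i k\<close>. The left side does not depend on
    \<open>i\<close>, so the minimum over components may be taken.\<close>
  have "real k * (?C * ?m\<^sup>2) \<le> Fx i 0 - l i" for i
    using bound[of k i] decseq_ge[OF Fx_decseq lim, of i k] by linarith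
  then have "real k * (?C * ?m\<^sup>2) \<le> (MIN i. Fx i 0 - l i)"
    by (subst Min_ge_iff) auto
  then have "sqrt (real k * (?C * ?m\<^sup>2)) \<le> sqrt (MIN i. Fx i 0 - l i)"
    by (rule real_sqrt_le_mono)
  then have "?m * (sqrt ?C * sqrt (real k)) \<le> sqrt (MIN i. Fx i 0 - l i)"
    using m0 by (simp add: real_sqrt_mult mult_ac)
  moreover have "0 < sqrt ?C * sqrt (real k)"
    using C k by (intro mult_pos_pos) auto
  ultimately show ?thesis
    by (simp only: pos_le_divide_eq)
qed

end

theorem theorem4p1:
  fixes f :: "'m::finite \<Rightarrow> real ^ 'n \<Rightarrow> real"
    and g :: "'m \<Rightarrow> real ^ 'n \<Rightarrow> ereal"
    and F :: "'m \<Rightarrow> real ^ 'n \<Rightarrow> ereal"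
    and \<Omega> :: "(real ^ 'n) set"
    and \<sigma> \<gamma> \<alpha>min \<alpha>max :: real
    and xm1 :: "real ^ 'n"
    and x d :: "nat \<Rightarrow> real ^ 'n"
    and t :: "nat \<Rightarrow> real"
  assumes F: "F = composite f g"
    and f: "\<And>i. continuously_diff (f i)"
    and g: "\<And>i. proper_ereal (g i)" "\<And>i. convex_ereal (g i)" "\<And>i. lsc_ereal (g i)"
    and \<Omega>: "\<Omega> = {z. \<forall>i. F i z \<le> F i (x 0)}"
    and x0: "\<And>i. F i (x 0) < \<infinity>"
    and bdd: "bounded \<Omega>"
    and \<sigma>: "0 < \<sigma>" "\<sigma> < 1"
    and \<gamma>: "0 < \<gamma>" "\<gamma> < 1"
    and \<alpha>: "0 < \<alpha>min" "\<alpha>min < \<alpha>max"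
    and run: "bbpgmo_run \<sigma> \<gamma> \<alpha>min \<alpha>max f g xm1 x d t"
    and noncrit: "\<And>k. \<not> pareto_critical F (x k)"
  shows "(\<exists>xs r. strict_mono r \<and> (x \<circ> r) \<longlonglongrightarrow> xs) \<and>
         (\<forall>xs r. strict_mono r \<and> (x \<circ> r) \<longlonglongrightarrow> xs \<longrightarrow> xs \<in> \<Omega> \<and> pareto_critical F xs) \<and>
         (\<forall>L :: 'm \<Rightarrow> real. (\<forall>i. 0 < L i \<and> L_smooth (L i) (f i)) \<longrightarrow>
           (\<exists>Fstar :: 'm \<Rightarrow> real.
              (\<forall>i. (\<lambda>k. F i (x k)) \<longlonglongrightarrow> ereal (Fstar i)) \<and>
              (let tbar = (MIN i. 2 * \<gamma> * (1 - \<sigma>) * \<alpha>min / L i);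
                   tmin = min tbar 1
               in \<forall>k\<ge>1. (MIN s\<in>{0..k-1}. norm (d s))
                    \<le> sqrt (MIN i. real_of_ereal (F i (x 0)) - Fstar i)
                       / (sqrt (\<sigma> * tmin * \<alpha>min) * sqrt (real k)))))"
proof -
  interpret bbpgmo f g \<sigma> \<gamma> \<alpha>min \<alpha>max xm1 x d t
    using assms by unfold_locales auto
  have "\<exists>Fstar. (\<forall>i. (\<lambda>k. F i (x k)) \<longlonglongrightarrow> ereal (Fstar i)) \<and>
      (let tbar = (MIN i. 2 * \<gamma> * (1 - \<sigma>) * \<alpha>min / L i);
           tmin = min tbar 1
       in \<forall>k\<ge>1. (MIN s\<in>{0..k-1}. norm (d s))
            \<le> sqrt (MIN i. real_of_ereal (F i (x 0)) - Fstar i)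
               / (sqrt (\<sigma> * tmin * \<alpha>min) * sqrt (real k)))"
    if L: "\<forall>i. 0 < L i \<and> L_smooth (L i) (f i)" for L
  proof -
    let ?tmin = "min (MIN i. 2 * \<gamma> * (1 - \<sigma>) * \<alpha>min / L i) 1"
    have "\<forall>i. \<exists>l. Fx i \<longlonglongrightarrow> l"
      using Fx_convergent by blast
    then obtain l where l: "\<And>i. Fx i \<longlonglongrightarrow> l i"
      by metis
    have "0 < ?tmin"
      using L \<gamma> \<sigma> \<alpha> by auto
    moreover have "?tmin \<le> t k" for k
      using L by (intro step_size_lower_bound) auto
    ultimately have "(MIN s\<in>{0..k-1}. norm (d s))
        \<le> sqrt (MIN i. Fx i 0 - l i) / (sqrt (\<sigma> * ?tmin * \<alpha>min) * sqrt (real k))" if "1 \<le> k" for k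
      using convergence_rate[OF l _ _ that] by blast
    then show ?thesis
      using l by (intro exI[of _ l]) (simp add: F composite_x Let_def)
  qed
  then show ?thesis
    using accumulation_point_exists accumulation_point_in_level_set accumulation_point_critical
    by (auto simp: F \<Omega>)
qed

end
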